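(* For every real $\varepsilon>0$ there is $n_0$ such that $c(G)\le (1/4+\varepsilon)n^2$ for every graph $G$ of order $n\ge n_0$.
   Context: Graphs are finite, simple and undirected; the order of a graph is its number of vertices. The acyclic orientation game on a graph $G$ (known to both players) is played by Algy and Strategist. At each step Algy selects any edge of $G$ and Strategist has to orient this edge; the only restriction on Strategist's replies is that the revealed partial orientation must be acyclic, that is, it contains no directed cycles. The game ends when the current partial orientation extends to a unique acyclic orientation of the whole graph $G$. Algy tries to minimize the number of steps, Strategist tries to maximize it. The parameter $c(G)$ is the length of the game (number of steps, i.e. edges queried) when both players play optimally. Equivalently, $c(G)$ is the smallest number such that Algy has an adaptive edge-querying strategy that determines a hidden acyclic orientation of $G$ using at most $c(G)$ queries, for every acyclic orientation of $G$. *)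

theory Defs
  imports Complex_Main
begin

definition simple_graph :: "'a set \<Rightarrow> 'a set set \<Rightarrow> bool" where
  "simple_graph V E \<longleftrightarrow> finite V \<and> (\<forall>e\<in>E. e \<subseteq> V \<and> card e = 2)"

text \<open>A (partial) orientation is the set of its arcs, where \<open>(u, v)\<close> is the edge \<open>{u, v}\<close>
  directed from \<open>u\<close> to \<open>v\<close>. Isolated vertices play no role, so only the edge set is a parameter.
  That every edge receives at most one direction is part of acyclicity, since opposite arcs form
  a directed cycle of length two.\<close>

definition acyclic_orientation :: "'a set set \<Rightarrow> ('a \<times> 'a) set \<Rightarrow> bool" where
  "acyclic_orientation E F \<longleftrightarrow>
     (\<forall>(u, v)\<in>F. {u, v} \<in> E) \<and>
     (\<forall>u v. {u, v} \<in> E \<longrightarrow> (u, v) \<in> F \<or> (v, u) \<in> F) \<and>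
     acyclic F"

definition game_over :: "'a set set \<Rightarrow> ('a \<times> 'a) set \<Rightarrow> bool" where
  "game_over E D \<longleftrightarrow> (\<exists>!F. acyclic_orientation E F \<and> D \<subseteq> F)"

text \<open>\<open>algy_wins E k D\<close>: from the revealed partial orientation \<open>D\<close>, Algy can force the game to end
  within \<open>k\<close> further steps. Algy may select an edge again; Strategist must then repeat the
  earlier answer, so this only wastes a step.\<close>

primrec algy_wins :: "'a set set \<Rightarrow> nat \<Rightarrow> ('a \<times> 'a) set \<Rightarrow> bool" where
  "algy_wins E 0 D \<longleftrightarrow> game_over E D"
| "algy_wins E (Suc k) D \<longleftrightarrow> game_over E D \<or>
     (\<exists>e\<in>E. \<forall>u v. {u, v} = e \<and> acyclic (insert (u, v) D) \<longrightarrow>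
        algy_wins E k (insert (u, v) D))"

definition game_length :: "'a set set \<Rightarrow> nat" where
  "game_length E = (LEAST k. algy_wins E k {})"

text \<open>The minimum above is attained: querying all edges always ends the game.\<close>

lemma game_over_complete:
  assumes "acyclic_orientation E D"
  shows "game_over E D"
  unfolding game_over_def
proof (rule ex1I[of _ D])
  show "acyclic_orientation E D \<and> D \<subseteq> D" using assms by simp
next
  fix F assume F: "acyclic_orientation E F \<and> D \<subseteq> F"
  have "(u, v) \<in> D" if "(u, v) \<in> F" for u v
  proof (rule ccontr)
    assume "(u, v) \<notin> D"
    moreover have "{u, v} \<in> E" using F that by (auto simp: acyclic_orientation_def)
    ultimately have "(v, u) \<in> D" using assms unfolding acyclic_orientation_def by blast
    then have "(v, u) \<in> F" using F by blast
    then have "(u, u) \<in> F\<^sup>+" using that by (meson trancl.simps)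
    then show False using F by (auto simp: acyclic_orientation_def acyclic_def)
  qed
  then show "F = D" using F by auto
qed

lemma algy_wins_unqueried:
  assumes "finite E" "\<forall>e\<in>E. card e = 2" "\<forall>(u, v)\<in>D. {u, v} \<in> E" "acyclic D"
    "card {e \<in> E. \<forall>u v. {u, v} = e \<longrightarrow> (u, v) \<notin> D} \<le> k"
  shows "algy_wins E k D"
  using assms(3-5)
proof (induction k arbitrary: D)
  case 0
  then have "{e \<in> E. \<forall>u v. {u, v} = e \<longrightarrow> (u, v) \<notin> D} = {}" using assms(1) by simp
  then have "(u, v) \<in> D \<or> (v, u) \<in> D" if "{u, v} \<in> E" for u v
    using that by (fastforce simp: doubleton_eq_iff)
  then have "acyclic_orientation E D" using 0 by (auto simp: acyclic_orientation_def)
  then show ?case by (simp add: game_over_complete)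
next
  case (Suc k)
  let ?U = "\<lambda>D. {e \<in> E. \<forall>u v. {u, v} = e \<longrightarrow> (u, v) \<notin> D}"
  show ?case
  proof (cases "?U D = {}")
    case True
    then have "(u, v) \<in> D \<or> (v, u) \<in> D" if "{u, v} \<in> E" for u v
      using that by (fastforce simp: doubleton_eq_iff)
    then have "acyclic_orientation E D" using Suc by (auto simp: acyclic_orientation_def)
    then show ?thesis by (simp add: game_over_complete)
  next
    case False
    then obtain e where e: "e \<in> ?U D" by blast
    have "algy_wins E k (insert (u, v) D)"
      if uv: "{u, v} = e" "acyclic (insert (u, v) D)" for u v
    proof (rule Suc.IH)
      show "\<forall>(a, b)\<in>insert (u, v) D. {a, b} \<in> E" using Suc.prems e uv by auto
      show "acyclic (insert (u, v) D)" by (fact uv)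
      have "?U (insert (u, v) D) \<subseteq> ?U D - {e}" using uv by auto
      then have "card (?U (insert (u, v) D)) \<le> card (?U D - {e})"
        using assms(1) by (intro card_mono) auto
      also have "\<dots> \<le> k" using e Suc.prems assms(1) by (simp add: card_Diff_singleton)
      finally show "card (?U (insert (u, v) D)) \<le> k" .
    qed
    then have "\<exists>e\<in>E. \<forall>u v. {u, v} = e \<and> acyclic (insert (u, v) D) \<longrightarrow>
        algy_wins E k (insert (u, v) D)"
      using e by blast
    then show ?thesis by (simp only: algy_wins.simps) blast
  qed
qed

lemma algy_wins_game_length:
  assumes "simple_graph V E"
  shows "algy_wins E (game_length E) {}"
proof -
  have "E \<subseteq> Pow V" "finite V" using assms by (auto simp: simple_graph_def)
  then have "finite E" by (meson finite_Pow_iff finite_subset)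
  then have "algy_wins E (card E) {}"
    using assms by (intro algy_wins_unqueried) (auto simp: simple_graph_def acyclic_def)
  then show ?thesis unfolding game_length_def by (rule LeastI)
qed

end

theory Submission
  imports Defs "HOL-Analysis.Convex" "HOL-Real_Asymp.Real_Asymp"
begin

text \<open>Why \<open>n\<^sup>2/4 + o(n\<^sup>2)\<close> questions suffice. Algy first asks a fixed set \<open>Q\<close> of only \<open>\<epsilon> n\<^sup>2\<close> edges.
  If the answers contain a directed path \<open>u \<rightarrow> w \<rightarrow> v\<close>, then an edge \<open>{u, v}\<close> is forced and need not
  be asked. Algy then asks all edges that no revealed path of length two forces; it
  remains to choose \<open>Q\<close> so that there are at most \<open>(1/4 + \<epsilon>) n\<^sup>2\<close> of these, whatever the answers.

  Extend the answers to an acyclic orientation \<open>F\<close> of the whole graph, given by ranking the vertices.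
  The unforced arcs of \<open>F\<close> are of two kinds.

  \<^item> Arcs \<open>(u, v)\<close> with fewer than \<open>\<delta> n\<close> paths \<open>u \<rightarrow> w \<rightarrow> v\<close> in \<open>F\<close>. Every triangle is oriented
    transitively, hence contains an arc bridged by its other two arcs, so these arcs span at most
    \<open>\<delta> n\<^sup>3\<close> triangles. Mantel's degree-sum argument tolerates so few triangles and bounds the
    number of arcs by \<open>n\<^sup>2/4 + O(\<delta> n\<^sup>2)\<close> (\<open>card_arcs_few_transitive_triangles\<close>).
  \<^item> Arcs with many such paths in \<open>F\<close>, none of which lies in \<open>Q\<close>. For random \<open>Q\<close> of
    constant density, one such arc survives with probability exponentially small in \<open>n\<close>, and the
    arcs of a matching survive almost independently, so that a given matching of linear size survives
    with probability \<open>exp (- c n\<^sup>2)\<close>. There are only \<open>exp (O (n ln n))\<close> choices of a ranking and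
    a matching, so some \<open>Q\<close> defeats all of them at once (\<open>exists_sparse_probe_set\<close>).
    The surviving arcs then contain no matching of size \<open>\<mu> n\<close>, and there are at most
    \<open>4 \<mu> n\<^sup>2\<close> of them (\<open>exists_matching\<close>).

  The union bound over all rankings is what makes one non-adaptive \<open>Q\<close> work against an adversary who
  sees \<open>Q\<close> before committing to an orientation.\<close>

section \<open>Matchings\<close>

text \<open>Used at two levels: for arcs, as pairs of vertices, and for paths of length two, as pairs
  of edges.\<close>

definition matching :: "('b \<times> 'b) set \<Rightarrow> bool" where
  "matching P \<longleftrightarrow> (\<forall>a b. (a, b) \<in> P \<longrightarrow> a \<noteq> b) \<and>
     (\<forall>a b c d. (a, b) \<in> P \<longrightarrow> (c, d) \<in> P \<longrightarrow> (a, b) \<noteq> (c, d) \<longrightarrow> {a, b} \<inter> {c, d} = {})"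

lemma matching_irrefl: "matching P \<Longrightarrow> (a, b) \<in> P \<Longrightarrow> a \<noteq> b"
  unfolding matching_def by blast

lemma matching_disjoint:
  "matching P \<Longrightarrow> (a, b) \<in> P \<Longrightarrow> (c, d) \<in> P \<Longrightarrow> (a, b) \<noteq> (c, d) \<Longrightarrow> {a, b} \<inter> {c, d} = {}"
  unfolding matching_def by (elim conjE allE impE) assumption+

lemma matching_mono:
  assumes "matching P" "P' \<subseteq> P"
  shows "matching P'"
  unfolding matching_def
proof (intro conjI allI impI)
  show "a \<noteq> b" if "(a, b) \<in> P'" for a b
    using matching_irrefl[OF assms(1)] that assms(2) by blast
  show "{a, b} \<inter> {c, d} = {}" if "(a, b) \<in> P'" "(c, d) \<in> P'" "(a, b) \<noteq> (c, d)" for a b c d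
    by (rule matching_disjoint[OF assms(1)]) (use that assms(2) in auto)
qed

lemma matching_insert:
  assumes "matching P" "a \<noteq> b" "\<And>c d. (c, d) \<in> P \<Longrightarrow> {a, b} \<inter> {c, d} = {}"
  shows "matching (insert (a, b) P)"
  unfolding matching_def
proof (intro conjI allI impI)
  fix x y assume "(x, y) \<in> insert (a, b) P"
  then show "x \<noteq> y" using assms(2) matching_irrefl[OF assms(1)] by blast
  fix c d assume cd: "(c, d) \<in> insert (a, b) P" "(x, y) \<noteq> (c, d)"
  have xy: "(x, y) \<in> insert (a, b) P" by fact
  consider "(x, y) = (a, b)" | "(c, d) = (a, b)" | "(x, y) \<noteq> (a, b)" "(c, d) \<noteq> (a, b)" by blast
  then show "{x, y} \<inter> {c, d} = {}"
  proof cases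
    case 1
    then have "(c, d) \<in> P" using cd by (metis insertE)
    from assms(3)[OF this] show ?thesis using 1 by simp
  next
    case 2
    then have "(x, y) \<in> P" using cd xy by (metis insertE)
    from assms(3)[OF this] show ?thesis using 2 by (simp add: Int_commute)
  next
    case 3
    then have "(x, y) \<in> P" "(c, d) \<in> P" using cd xy by auto
    from matching_disjoint[OF assms(1) this cd(2)] show ?thesis .
  qed
qed

text \<open>Greedy choice: removing all pairs that touch the two ends of a chosen pair costs at most
  \<open>4 * card V\<close> pairs.\<close>

lemma exists_matching:
  assumes V: "finite V" "V \<noteq> {}" and X: "X \<subseteq> V \<times> V" "irrefl X" "4 * m * card V \<le> card X"
  shows "\<exists>M\<subseteq>X. matching M \<and> card M = m"
  using X
proof (induction m arbitrary: X)
  case 0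
  then show ?case by (intro exI[of _ "{}"]) (simp add: matching_def)
next
  case (Suc m)
  have pos: "card V > 0" using V by (simp add: card_gt_0_iff)
  have "0 < 4 * Suc m * card V" using pos by simp
  with Suc.prems(3) have "card X \<noteq> 0" by linarith
  then have "X \<noteq> {}" by auto
  then obtain u v where uv: "(u, v) \<in> X" by auto
  let ?T = "{u} \<times> V \<union> V \<times> {u} \<union> ({v} \<times> V \<union> V \<times> {v})"
  have "card ({x} \<times> V \<union> V \<times> {x}) \<le> 2 * card V" for x
    using card_Un_le[of "{x} \<times> V" "V \<times> {x}"] by (simp add: card_cartesian_product)
  from this[of u] this[of v] have "card ?T \<le> 4 * card V"
    using card_Un_le[of "{u} \<times> V \<union> V \<times> {u}" "{v} \<times> V \<union> V \<times> {v}"] by linarith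
  then have "card X - 4 * card V \<le> card (X - ?T)"
    using diff_card_le_card_Diff[of ?T X] V by simp
  moreover have "4 * m * card V \<le> card X - 4 * card V" using Suc.prems(3) by (simp add: algebra_simps)
  ultimately have "4 * m * card V \<le> card (X - ?T)" by linarith
  then have "\<exists>M\<subseteq>X - ?T. matching M \<and> card M = m"
    using Suc.prems(1,2) by (intro Suc.IH) (auto simp: irrefl_def)
  then obtain M where M: "M \<subseteq> X - ?T" "matching M" "card M = m" by blast
  have finM: "finite M" using M(1) Suc.prems(1) V by (meson Diff_subset finite_SigmaI finite_subset)
  have sep: "{u, v} \<inter> {c, d} = {}" if "(c, d) \<in> M" for c d
    using that M(1) Suc.prems(1) by auto
  have "matching (insert (u, v) M)"
    using M(2) sep uv Suc.prems(2) by (intro matching_insert) (auto simp: irrefl_def)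
  moreover have "(u, v) \<notin> M" using sep by blast
  ultimately show ?case
    using M uv finM by (intro exI[of _ "insert (u, v) M"]) auto
qed

section \<open>Colourings that make a pair monochromatic\<close>

text \<open>In a random \<open>k\<close>-colouring each pair is monochromatic of colour \<open>j\<close> with probability
  \<open>1 / k\<^sup>2\<close>, independently for disjoint pairs. The argument counts colourings, splitting off one pair
  at a time.\<close>

lemma card_colourings_avoiding_matching:
  fixes k j :: nat
  assumes "finite P" "finite E" "matching P" "P \<subseteq> E \<times> E" "j < k"
  shows "real (card {f \<in> E \<rightarrow>\<^sub>E {..<k}. \<forall>(a, b)\<in>P. \<not> (f a = j \<and> f b = j)})
           \<le> real k ^ card E * (1 - 1 / real k ^ 2) ^ card P"
  using assms
proof (induction P arbitrary: E rule: finite_induct)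
  case empty
  have "card (E \<rightarrow>\<^sub>E {..<k}) = k ^ card E"
    using empty by (simp add: card_PiE)
  then show ?case by simp
next
  case (insert p P)
  obtain a b where p: "p = (a, b)" by fastforce
  define E' where "E' = E - {a, b}"
  have ab: "a \<noteq> b" "a \<in> E" "b \<in> E" using insert.prems p matching_irrefl[of "insert p P" a b] by auto
  have disj: "{a, b} \<inter> {c, d} = {}" if "(c, d) \<in> P" for c d
    using insert.prems(2) insert.hyps(2) that p by (intro matching_disjoint[of "insert p P"]) auto
  have PE': "P \<subseteq> E' \<times> E'"
  proof
    fix q assume "q \<in> P"
    then show "q \<in> E' \<times> E'"
      using disj[of "fst q" "snd q"] insert.prems(3) unfolding E'_def by (cases q) auto
  qed
  have fin: "finite E'" using insert.prems E'_def by simp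
  have cE: "card E = card E' + 2"
    using ab insert.prems(1) card_Diff_subset[of "{a,b}" E] card_mono[of E "{a,b}"]
    unfolding E'_def by simp
  let ?A = "\<lambda>E P. {f \<in> E \<rightarrow>\<^sub>E {..<k}. \<forall>(a, b)\<in>P. \<not> (f a = j \<and> f b = j)}"
  let ?B = "{..<k} \<times> {..<k} - {(j, j)}"
  have cB: "real (card ?B) = real k ^ 2 * (1 - 1 / real k ^ 2)"
    using assms(5) by (simp add: card_Diff_singleton field_simps power2_eq_square of_nat_diff Suc_leI)
  have finA: "finite (?A E' P)" using fin by (simp add: finite_PiE)
  have "card (?A E (insert p P)) \<le> card (?A E' P \<times> ?B)"
  proof (rule card_inj_on_le)
    let ?g = "\<lambda>f. (restrict f E', f a, f b)"
    show "inj_on ?g (?A E (insert p P))"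
    proof (rule inj_onI)
      fix f h assume f: "f \<in> ?A E (insert p P)" and h: "h \<in> ?A E (insert p P)" and eq: "?g f = ?g h"
      show "f = h"
      proof (rule PiE_ext)
        show "f \<in> E \<rightarrow>\<^sub>E {..<k}" "h \<in> E \<rightarrow>\<^sub>E {..<k}" using f h by auto
        fix x assume "x \<in> E"
        have r: "restrict f E' = restrict h E'" and fab: "f a = h a" "f b = h b" using eq by auto
        have "restrict f E' x = restrict h E' x" by (rule fun_cong[OF r])
        then show "f x = h x"
          using fab \<open>x \<in> E\<close> by (cases "x = a \<or> x = b") (auto simp: E'_def restrict_apply)
      qed
    qed
    show "?g ` ?A E (insert p P) \<subseteq> ?A E' P \<times> ?B"
    proof
      fix y assume "y \<in> ?g ` ?A E (insert p P)"
      then obtain f where f: "f \<in> ?A E (insert p P)" and y: "y = ?g f" by blast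
      have "restrict f E' \<in> E' \<rightarrow>\<^sub>E {..<k}" using f unfolding E'_def by auto
      moreover have "\<forall>(a, b)\<in>P. \<not> (restrict f E' a = j \<and> restrict f E' b = j)"
        using f PE' by auto
      moreover have "(f a, f b) \<in> ?B" using f ab p by auto
      ultimately show "y \<in> ?A E' P \<times> ?B" using y by simp
    qed
    show "finite (?A E' P \<times> ?B)" using finA by simp
  qed
  then have "real (card (?A E (insert p P))) \<le> real (card (?A E' P)) * real (card ?B)"
    by (simp only: card_cartesian_product of_nat_mult[symmetric] of_nat_le_iff)
  also have "\<dots> \<le> (real k ^ card E' * (1 - 1 / real k ^ 2) ^ card P) * real (card ?B)"
    using insert.IH[OF fin matching_mono[OF insert.prems(2) subset_insertI] PE' assms(5)]
    by (intro mult_right_mono) auto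
  also have "\<dots> = real k ^ card E * (1 - 1 / real k ^ 2) ^ card (insert p P)"
    unfolding cB cE card_insert_disjoint[OF insert.hyps] power_add power_Suc
    by (simp only: ac_simps)
  finally show ?case .
qed

text \<open>A random set \<open>Q\<close> of density \<open>1 / k\<close> is obtained as a colour class of a random \<open>k\<close>-colouring.
  By the union bound some colouring is good for all its colours simultaneously, which
  leaves the freedom to take the smallest class and so bounds the size of \<open>Q\<close> without
  a concentration inequality.\<close>

lemma exists_sparse_set_hitting_matchings:
  fixes k N :: nat and \<B> :: "('b \<times> 'b) set set"
  assumes E: "finite E" and B: "finite \<B>" and k: "k > 0"
    and P: "\<And>P. P \<in> \<B> \<Longrightarrow> matching P \<and> P \<subseteq> E \<times> E \<and> N \<le> card P"
    and small: "real k * real (card \<B>) * (1 - 1 / real k ^ 2) ^ N < 1"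
  shows "\<exists>Q\<subseteq>E. k * card Q \<le> card E \<and> (\<forall>P\<in>\<B>. \<exists>(a, b)\<in>P. a \<in> Q \<and> b \<in> Q)"
proof -
  define q where "q = 1 - 1 / real k ^ 2"
  have q: "0 \<le> q" "q \<le> 1" using k unfolding q_def by (auto simp: field_simps)
  let ?A = "\<lambda>P j. {f \<in> E \<rightarrow>\<^sub>E {..<k}. \<forall>(a, b)\<in>P. \<not> (f a = j \<and> f b = j)}"
  have bound: "real (card (?A P j)) \<le> real k ^ card E * q ^ N" if "P \<in> \<B>" "j < k" for P j
  proof -
    have "finite P" using P[OF that(1)] E by (meson finite_SigmaI finite_subset)
    then have "real (card (?A P j)) \<le> real k ^ card E * q ^ card P"
      unfolding q_def using P[OF that(1)] that(2) E by (intro card_colourings_avoiding_matching) auto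
    also have "\<dots> \<le> real k ^ card E * q ^ N"
      using q P[OF that(1)] by (intro mult_left_mono power_decreasing) auto
    finally show ?thesis .
  qed
  have "\<exists>f\<in>E \<rightarrow>\<^sub>E {..<k}. \<forall>P\<in>\<B>. \<forall>j<k. f \<notin> ?A P j"
  proof (rule ccontr)
    assume "\<not> ?thesis"
    then have sub: "(E \<rightarrow>\<^sub>E {..<k}) \<subseteq> (\<Union>z\<in>\<B> \<times> {..<k}. ?A (fst z) (snd z))" by fastforce
    have "real k ^ card E = real (card (E \<rightarrow>\<^sub>E {..<k}))"
      using E by (simp add: card_PiE)
    also have "\<dots> \<le> real (card (\<Union>z\<in>\<B> \<times> {..<k}. ?A (fst z) (snd z)))"
      using B E by (intro of_nat_mono card_mono sub finite_UN_I) (auto simp: finite_PiE)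
    also have "\<dots> \<le> real (\<Sum>z\<in>\<B> \<times> {..<k}. card (?A (fst z) (snd z)))"
      using B by (intro of_nat_mono card_UN_le) auto
    also have "\<dots> = (\<Sum>z\<in>\<B> \<times> {..<k}. real (card (?A (fst z) (snd z))))" by simp
    also have "\<dots> \<le> (\<Sum>z\<in>\<B> \<times> {..<k}. real k ^ card E * q ^ N)"
      by (intro sum_mono bound) auto
    also have "\<dots> = real k ^ card E * (real k * real (card \<B>) * q ^ N)"
      by (simp add: card_cartesian_product)
    also have "\<dots> < real k ^ card E * 1"
      using small k unfolding q_def by (intro mult_strict_left_mono) auto
    finally show False by simp
  qed
  then obtain f where f: "f \<in> E \<rightarrow>\<^sub>E {..<k}" "\<And>P j. P \<in> \<B> \<Longrightarrow> j < k \<Longrightarrow> f \<notin> ?A P j" by blast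
  have "\<exists>j<k. k * card {e \<in> E. f e = j} \<le> card E"
  proof (rule ccontr)
    assume "\<not> ?thesis"
    then have "(\<Sum>j<k. card E) < (\<Sum>j<k. k * card {e \<in> E. f e = j})"
      using k by (intro sum_strict_mono) (auto simp: not_le)
    also have "\<dots> = k * card (\<Union>j<k. {e \<in> E. f e = j})"
      using E by (subst card_UN_disjoint) (auto simp: sum_distrib_left)
    also have "(\<Union>j<k. {e \<in> E. f e = j}) = E" using f(1) by auto
    finally show False by simp
  qed
  then obtain j where j: "j < k" "k * card {e \<in> E. f e = j} \<le> card E" by blast
  have "\<exists>(a, b)\<in>P. a \<in> {e \<in> E. f e = j} \<and> b \<in> {e \<in> E. f e = j}" if "P \<in> \<B>" for P
    using f(2)[OF that j(1)] f(1) P[OF that] by fastforce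
  with j show ?thesis by (intro exI[of _ "{e \<in> E. f e = j}"]) auto
qed

section \<open>Arcs with few bridging paths\<close>

text \<open>Mantel's proof with an error term. For adjacent \<open>u\<close> and \<open>v\<close>, the sum of the degrees is
  at most \<open>n\<close> plus the number of common neighbours. Summing over all edges gives
  \<open>\<Sum> d\<^sup>2 \<le> m n + 3 T\<close> for \<open>m\<close> edges and \<open>T\<close> triangles, and Cauchy's inequality bounds \<open>\<Sum> d\<^sup>2\<close> from
  below by \<open>(2 m)\<^sup>2 / n\<close>. As \<open>r\<close> increases along the arcs, no triangle is cyclic; each is therefore counted
  at its bridging arc, so \<open>T \<le> m t\<close>.\<close>

lemma card_arcs_few_transitive_triangles:
  fixes r :: "'a \<Rightarrow> nat" and t :: real
  assumes V: "finite V" and R: "R \<subseteq> V \<times> V" and r: "\<And>u v. (u, v) \<in> R \<Longrightarrow> r u < r v"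
    and t0: "t \<ge> 0" and t: "\<And>u v. (u, v) \<in> R \<Longrightarrow> real (card {w. (u, w) \<in> R \<and> (w, v) \<in> R}) \<le> t"
  shows "4 * real (card R) \<le> real (card V) ^ 2 + 3 * t * real (card V)"
proof (cases "R = {}")
  case True
  then show ?thesis using t0 by simp
next
  case False
  have finR: "finite R" using R V by (meson finite_SigmaI finite_subset)
  define n where "n = real (card V)"
  define m where "m = real (card R)"
  have m: "m > 0" using False finR by (simp add: m_def card_gt_0_iff)
  \<comment> \<open>Degrees and common neighbours are those of the underlying undirected graph.\<close>
  define S where "S = R \<union> R\<inverse>"
  have SV: "S \<subseteq> V \<times> V" and finS: "finite S" using R finR by (auto simp: S_def)
  have symS: "(v, u) \<in> S \<longleftrightarrow> (u, v) \<in> S" for u v by (auto simp: S_def)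
  have cS: "real (card S) = 2 * m"
  proof -
    have "R \<inter> R\<inverse> = {}" using r by (auto dest!: r)
    then show ?thesis unfolding S_def m_def using finR by (simp add: card_Un_disjoint)
  qed
  define d where "d v = real (card (S `` {v}))" for v
  have NV: "S `` {v} \<subseteq> V" for v using SV by blast
  then have finN: "finite (S `` {v})" for v using V finite_subset by blast
  have sum_d: "(\<Sum>v\<in>V. d v) = 2 * m"
  proof -
    have "S = Sigma V (\<lambda>v. S `` {v})" using SV by auto
    then have "card S = (\<Sum>v\<in>V. card (S `` {v}))"
      using card_SigmaI[OF V, of "\<lambda>v. S `` {v}"] finN by simp
    then show ?thesis using cS unfolding d_def by simp
  qed
  have sum_sq: "(\<Sum>(u, v)\<in>S. d u) = (\<Sum>v\<in>V. d v ^ 2)"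
  proof -
    have "S = Sigma V (\<lambda>v. S `` {v})" using SV by auto
    then have "(\<Sum>(u, v)\<in>S. d u) = (\<Sum>(u, v)\<in>Sigma V (\<lambda>v. S `` {v}). d u)" by simp
    also have "\<dots> = (\<Sum>u\<in>V. \<Sum>v\<in>S `` {u}. d u)" using V finN by (subst sum.Sigma) auto
    also have "\<dots> = (\<Sum>v\<in>V. d v ^ 2)" by (simp add: d_def power2_eq_square)
    finally show ?thesis .
  qed
  have sum_sq': "(\<Sum>(u, v)\<in>S. d v) = (\<Sum>v\<in>V. d v ^ 2)"
    unfolding sum_sq[symmetric]
    by (rule sum.reindex_bij_witness[of _ prod.swap prod.swap]) (auto simp: symS)
  let ?C = "\<lambda>p. S `` {fst p} \<inter> S `` {snd p}"
  have deg: "d u + d v \<le> n + real (card (?C (u, v)))" for u v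
  proof -
    have "card (S `` {u} \<union> S `` {v}) \<le> card V" using NV by (intro card_mono V) auto
    then show ?thesis using card_Un_Int[OF finN finN, of u v] unfolding d_def n_def by simp
  qed
  define T where "T = Sigma R (\<lambda>p. {w. (fst p, w) \<in> R \<and> (w, snd p) \<in> R})"
  have finT: "finite T"
  proof -
    have "T \<subseteq> R \<times> V" using R unfolding T_def by auto
    then show ?thesis using finR V by (meson finite_SigmaI finite_subset)
  qed
  have cT: "real (card T) \<le> m * t"
  proof -
    have "finite {w. (fst p, w) \<in> R \<and> (w, snd p) \<in> R}" for p
      by (rule finite_subset[OF _ V]) (use R in auto)
    then have "real (card T) = (\<Sum>p\<in>R. real (card {w. (fst p, w) \<in> R \<and> (w, snd p) \<in> R}))"
      unfolding T_def using finR by simp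
    also have "\<dots> \<le> (\<Sum>p\<in>R. t)" using t by (intro sum_mono) auto
    finally show ?thesis by (simp add: m_def)
  qed
  have triples: "real (\<Sum>p\<in>S. card (?C p)) \<le> 6 * (m * t)"
  proof -
    \<comment> \<open>A triangle has six ordered labellings, and one of them lists it as source, sink, middle.\<close>
    let ?U = "T \<union> ((\<lambda>((x, z), y). ((x, y), z)) ` T \<union> ((\<lambda>((x, z), y). ((z, x), y)) ` T
      \<union> ((\<lambda>((x, z), y). ((y, x), z)) ` T \<union> ((\<lambda>((x, z), y). ((z, y), x)) ` T
      \<union> (\<lambda>((x, z), y). ((y, z), x)) ` T))))"
    have "z \<in> ?U" if z: "z \<in> Sigma S ?C" for z
    proof -
      obtain u v w where zz: "z = ((u, v), w)" by (metis prod.exhaust)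
      have "(u, v) \<in> R \<or> (v, u) \<in> R" "(u, w) \<in> R \<or> (w, u) \<in> R" "(v, w) \<in> R \<or> (w, v) \<in> R"
        using z zz by (auto simp: S_def)
      moreover have "\<not> ((a, b) \<in> R \<and> (b, c) \<in> R \<and> (c, a) \<in> R)" for a b c
        using r[of a b] r[of b c] r[of c a] by linarith
      ultimately have "((u, v), w) \<in> T \<or> ((v, u), w) \<in> T \<or> ((u, w), v) \<in> T
          \<or> ((w, u), v) \<in> T \<or> ((v, w), u) \<in> T \<or> ((w, v), u) \<in> T"
        unfolding T_def mem_Sigma_iff mem_Collect_eq fst_conv snd_conv by metis
      then show ?thesis
        unfolding zz by (elim disjE) (force intro: rev_image_eqI)+
    qed
    then have "card (Sigma S ?C) \<le> card ?U"
      using finT by (intro card_mono) auto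
    also have "\<dots> \<le> card T + (card T + (card T + (card T + (card T + card T))))"
      using finT by (intro order_trans[OF card_Un_le add_mono] card_image_le order_refl)
    finally have "real (card (Sigma S ?C)) \<le> 6 * real (card T)" by linarith
    moreover have "card (Sigma S ?C) = (\<Sum>p\<in>S. card (?C p))"
      using finS finN by (intro card_SigmaI) auto
    ultimately show ?thesis using cT by simp
  qed
  have "2 * (\<Sum>v\<in>V. d v ^ 2) = (\<Sum>p\<in>S. d (fst p) + d (snd p))"
    using sum_sq sum_sq' by (simp add: sum.distrib case_prod_unfold)
  also have "\<dots> \<le> (\<Sum>p\<in>S. n + real (card (?C p)))"
    by (intro sum_mono) (metis deg prod.collapse)
  also have "\<dots> = 2 * m * n + real (\<Sum>p\<in>S. card (?C p))" using cS by (simp add: sum.distrib)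
  also have "\<dots> \<le> 2 * m * n + 6 * (m * t)" using triples by simp
  finally have sq: "(\<Sum>v\<in>V. d v ^ 2) \<le> m * n + 3 * (m * t)" by simp
  have "(2 * m) ^ 2 \<le> n * (\<Sum>v\<in>V. d v ^ 2)"
    using sum_squared_le_sum_of_squares[of d V] V unfolding sum_d n_def by (simp add: mult.commute)
  also have "\<dots> \<le> n * (m * n + 3 * (m * t))" using sq by (intro mult_left_mono) (auto simp: n_def)
  finally have "m * (4 * m) \<le> m * (n ^ 2 + 3 * t * n)" by (simp add: power2_eq_square algebra_simps)
  then show ?thesis using m unfolding m_def n_def by simp
qed

section \<open>Orientations given by rankings\<close>

definition ranked_arcs :: "'a set set \<Rightarrow> ('a \<Rightarrow> nat) \<Rightarrow> ('a \<times> 'a) set" where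
  "ranked_arcs E r = {(u, v). {u, v} \<in> E \<and> r u < r v}"

lemma simple_graph_edgeD:
  assumes "simple_graph V E" "{u, v} \<in> E"
  shows "u \<in> V" "v \<in> V" "u \<noteq> v"
proof -
  have "{u, v} \<subseteq> V \<and> card {u, v} = 2" using assms unfolding simple_graph_def by blast
  then show "u \<in> V" "v \<in> V" "u \<noteq> v" by (auto simp: card_insert_if split: if_splits)
qed

text \<open>Ordering by the number of ancestors respects \<open>D\<close>; an arbitrary enumeration of \<open>V\<close> breaks the
  ties. The explicit bound on the ranks is what allows rankings to be counted later.\<close>

lemma exists_ranking:
  assumes VE: "simple_graph V E" and D: "\<forall>(u, v)\<in>D. {u, v} \<in> E" "acyclic D"
  shows "\<exists>r. inj_on r V \<and> (\<forall>v\<in>V. r v < card V ^ 2) \<and> D \<subseteq> ranked_arcs E r"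
proof -
  have V: "finite V" using VE by (simp add: simple_graph_def)
  have DV: "D \<subseteq> V \<times> V" using D(1) simple_graph_edgeD[OF VE] by fast
  obtain g where g: "bij_betw g V {0..<card V}" using ex_bij_betw_finite_nat[OF V] by blast
  have gV: "g v < card V" if "v \<in> V" for v using g that bij_betwE by fastforce
  define anc where "anc v = {u. (u, v) \<in> D\<^sup>+}" for v
  have ancV: "anc v \<subseteq> V" for v using trancl_subset_Sigma[OF DV] unfolding anc_def by blast
  have ancv: "v \<notin> anc v" for v using D(2) by (simp add: anc_def acyclic_def)
  have anc_lt: "card (anc v) < card V" if "v \<in> V" for v
    using ancV[of v] ancv[of v] that V by (intro psubset_card_mono) auto
  define r where "r v = card (anc v) * card V + g v" for v
  have "r u < r v" if "(u, v) \<in> D" for u v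
  proof -
    have "u \<in> anc v" "anc u \<subseteq> anc v" using that unfolding anc_def by auto
    then have "card (anc u) < card (anc v)"
      using ancv[of u] ancV[of v] V by (intro psubset_card_mono) (auto intro: finite_subset)
    then have "Suc (card (anc u)) * card V \<le> card (anc v) * card V" by (intro mult_le_mono1) simp
    then show ?thesis using gV[of u] that DV unfolding r_def by auto
  qed
  then have "D \<subseteq> ranked_arcs E r" using D(1) by (auto simp: ranked_arcs_def)
  moreover have "inj_on r V"
  proof (rule inj_onI)
    fix u v assume uv: "u \<in> V" "v \<in> V" "r u = r v"
    have "r x mod card V = g x" if "x \<in> V" for x using gV[OF that] by (simp add: r_def)
    from this[OF uv(1)] this[OF uv(2)] have "g u = g v" using uv(3) by simp
    then show "u = v" using g uv by (meson bij_betw_imp_inj_on inj_onD)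
  qed
  moreover have "r v < card V ^ 2" if "v \<in> V" for v
  proof -
    have "Suc (card (anc v)) * card V \<le> card V * card V" using anc_lt[OF that] by (intro mult_le_mono1) simp
    then show ?thesis using gV[OF that] unfolding r_def by (simp add: power2_eq_square)
  qed
  ultimately show ?thesis by blast
qed

lemma ranked_arcs_acyclic_orientation:
  assumes VE: "simple_graph V E" and r: "inj_on r V"
  shows "acyclic_orientation E (ranked_arcs E r)"
proof -
  have EV: "\<And>u v. {u, v} \<in> E \<Longrightarrow> u \<in> V \<and> v \<in> V \<and> u \<noteq> v"
    using simple_graph_edgeD[OF VE] by blast
  have "wf (ranked_arcs E r)"
    by (rule wf_subset[OF wf_measure[of r]]) (auto simp: ranked_arcs_def)
  then have "acyclic (ranked_arcs E r)" by (rule wf_acyclic)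
  moreover have "(u, v) \<in> ranked_arcs E r \<or> (v, u) \<in> ranked_arcs E r" if e: "{u, v} \<in> E" for u v
  proof -
    have "r u \<noteq> r v" using EV[OF e] r by (meson inj_onD)
    then show ?thesis using e by (auto simp: ranked_arcs_def insert_commute)
  qed
  ultimately show ?thesis by (auto simp: acyclic_orientation_def ranked_arcs_def)
qed

section \<open>Rules for playing the game\<close>

lemma algy_wins_Suc: "algy_wins E k D \<Longrightarrow> algy_wins E (Suc k) D"
proof (induction k arbitrary: D)
  case (Suc k)
  show ?case
  proof (cases "game_over E D")
    case False
    then obtain e where "e \<in> E"
      "\<And>u v. {u, v} = e \<Longrightarrow> acyclic (insert (u, v) D) \<Longrightarrow> algy_wins E k (insert (u, v) D)"
      using Suc.prems by auto
    then have "\<exists>e\<in>E. \<forall>u v. {u, v} = e \<and> acyclic (insert (u, v) D) \<longrightarrow>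
        algy_wins E (Suc k) (insert (u, v) D)"
      by (intro bexI[of _ e] allI impI Suc.IH) auto
    then show ?thesis by (subst algy_wins.simps) (rule disjI2)
  qed simp
qed simp

lemma algy_wins_mono: "algy_wins E k D \<Longrightarrow> k \<le> l \<Longrightarrow> algy_wins E l D"
  using algy_wins_Suc by (induction l) (auto simp: le_Suc_eq simp del: algy_wins.simps)

text \<open>Algy may ask a fixed set of edges as a block before adapting to the answers.\<close>

lemma algy_wins_after_queries:
  assumes "finite Q" "Q \<subseteq> E" "\<forall>e\<in>E. card e = 2"
    and "\<forall>(u, v)\<in>D. {u, v} \<in> E" "acyclic D"
    and "\<And>D'. D \<subseteq> D' \<Longrightarrow> \<forall>(u, v)\<in>D'. {u, v} \<in> E \<Longrightarrow> acyclic D' \<Longrightarrow>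
           \<forall>u v. {u, v} \<in> Q \<longrightarrow> (u, v) \<in> D' \<or> (v, u) \<in> D' \<Longrightarrow> algy_wins E k D'"
  shows "algy_wins E (card Q + k) D"
  using assms(1,2,4-)
proof (induction Q arbitrary: D rule: finite_induct)
  case empty
  have "algy_wins E k D" by (rule empty.prems(4)) (use empty.prems(2,3) in auto)
  then show ?case by simp
next
  case (insert e Q)
  have "algy_wins E (card Q + k) (insert (u, v) D)"
    if uv: "{u, v} = e" "acyclic (insert (u, v) D)" for u v
  proof (rule insert.IH)
    show "Q \<subseteq> E" using insert.prems by simp
    show "\<forall>(u, v)\<in>insert (u, v) D. {u, v} \<in> E" using insert.prems uv by auto
    show "acyclic (insert (u, v) D)" by (fact uv)
    fix D' assume D': "insert (u, v) D \<subseteq> D'" "\<forall>(u, v)\<in>D'. {u, v} \<in> E" "acyclic D'"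
      "\<forall>u v. {u, v} \<in> Q \<longrightarrow> (u, v) \<in> D' \<or> (v, u) \<in> D'"
    show "algy_wins E k D'"
    proof (rule insert.prems(4))
      show "\<forall>x y. {x, y} \<in> insert e Q \<longrightarrow> (x, y) \<in> D' \<or> (y, x) \<in> D'"
        using D'(1,4) uv by (auto simp: doubleton_eq_iff)
    qed (use D' in auto)
  qed
  then have "\<exists>e\<in>E. \<forall>u v. {u, v} = e \<and> acyclic (insert (u, v) D) \<longrightarrow>
      algy_wins E (card Q + k) (insert (u, v) D)"
    using insert.prems(1) by (intro bexI[of _ e]) (simp_all del: acyclic_insert)
  then have "algy_wins E (Suc (card Q + k)) D" by (subst algy_wins.simps) (rule disjI2)
  then show ?case using insert.hyps by simp
qed

lemma game_over_if_two_paths: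
  assumes VE: "simple_graph V E" and D: "\<forall>(u, v)\<in>D. {u, v} \<in> E" "acyclic D"
    and cov: "\<And>u v. {u, v} \<in> E \<Longrightarrow>
       (u, v) \<in> D \<or> (v, u) \<in> D \<or> (u, v) \<in> D O D \<or> (v, u) \<in> D O D"
  shows "game_over E D"
proof -
  obtain r where r: "inj_on r V" "D \<subseteq> ranked_arcs E r" using exists_ranking[OF VE D] by blast
  have sub: "F \<subseteq> F'" if F: "acyclic_orientation E F" "D \<subseteq> F" and F': "acyclic_orientation E F'" "D \<subseteq> F'" for F F'
  proof
    fix p assume "p \<in> F"
    then obtain u v where p: "p = (u, v)" and uv: "(u, v) \<in> F" by (cases p) auto
    then have e: "{u, v} \<in> E" using F by (auto simp: acyclic_orientation_def)
    have acF: "acyclic F" "acyclic F'" using F F' by (auto simp: acyclic_orientation_def)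
    have DF: "D\<^sup>+ \<subseteq> F\<^sup>+" "D\<^sup>+ \<subseteq> F'\<^sup>+" using F(2) F'(2) by (auto intro: trancl_mono)
    have "(v, u) \<notin> D\<^sup>+"
    proof
      assume "(v, u) \<in> D\<^sup>+"
      then have "(u, u) \<in> F\<^sup>+" using uv DF by (meson subsetD trancl_into_trancl2)
      then show False using acF by (simp add: acyclic_def)
    qed
    moreover have "D \<union> D O D \<subseteq> D\<^sup>+" by auto
    ultimately have "(u, v) \<in> D\<^sup>+" using cov[OF e] by blast
    then have "(u, v) \<in> F'\<^sup>+" using DF by blast
    then have "(v, u) \<notin> F'" using acF unfolding acyclic_def by (meson trancl_into_trancl)
    then show "p \<in> F'" using F'(1) e p by (auto simp: acyclic_orientation_def)
  qed
  show ?thesis unfolding game_over_def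
  proof (rule ex1I[of _ "ranked_arcs E r"])
    show *: "acyclic_orientation E (ranked_arcs E r) \<and> D \<subseteq> ranked_arcs E r"
      using ranked_arcs_acyclic_orientation[OF VE r(1)] r(2) by blast
    show "F = ranked_arcs E r" if "acyclic_orientation E F \<and> D \<subseteq> F" for F
      using sub that * by blast
  qed
qed

section \<open>The probe set\<close>

text \<open>Disjointness of the paths is what turns into independence below. It is the reason to admit
  only middle vertices outside the matching: an edge of such a path then determines both its middle
  vertex and the arc that the path bridges.\<close>

lemma matching_two_paths:
  fixes M :: "('a \<times> 'a) set" and W :: "'a \<times> 'a \<Rightarrow> 'a set"
  defines "f \<equiv> \<lambda>((u, v), w). ({u, w}, {w, v})"
  assumes M: "matching M" and W: "\<And>p w. p \<in> M \<Longrightarrow> w \<in> W p \<Longrightarrow> w \<notin> Field M"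
  shows "matching (f ` Sigma M W)" "inj_on f (Sigma M W)"
proof -
  have same: "u = u' \<and> v = v' \<and> w = w'"
    if uv: "(u, v) \<in> M" "w \<in> W (u, v)" and uv': "(u', v') \<in> M" "w' \<in> W (u', v')"
      and meet: "{{u, w}, {w, v}} \<inter> {{u', w'}, {w', v'}} \<noteq> {}" for u v w u' v' w'
  proof -
    have fld: "u \<in> Field M" "v \<in> Field M" "u' \<in> Field M" "v' \<in> Field M"
      using uv(1) uv'(1) by (auto simp: Field_def)
    have w: "w \<notin> Field M" "w' \<notin> Field M" using W uv uv' by blast+
    obtain x x' where x: "x \<in> {u, v}" "x' \<in> {u', v'}" "{x, w} = {x', w'}"
      using meet by (auto simp: insert_commute)
    have "x \<in> Field M" "x' \<in> Field M" using x fld by auto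
    then have "x = x'" "w = w'" using x(3) w by (auto simp: doubleton_eq_iff)
    then show ?thesis using matching_disjoint[OF M uv(1) uv'(1)] x(1,2) by blast
  qed
  show "inj_on f (Sigma M W)"
  proof (rule inj_onI)
    fix p q assume p: "p \<in> Sigma M W" and q: "q \<in> Sigma M W" and eq: "f p = f q"
    obtain u v w u' v' w' where pq: "p = ((u, v), w)" "q = ((u', v'), w')" by (metis prod.exhaust)
    show "p = q" using same[of u v w u' v' w'] p q eq unfolding pq f_def by simp
  qed
  show "matching (f ` Sigma M W)"
    unfolding matching_def
  proof (intro conjI allI impI)
    fix a b assume "(a, b) \<in> f ` Sigma M W"
    then obtain u v w where uv: "(u, v) \<in> M" "w \<in> W (u, v)" "a = {u, w}" "b = {w, v}"
      unfolding f_def by auto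
    show "a \<noteq> b" using matching_irrefl[OF M uv(1)] unfolding uv(3,4) by (auto simp: doubleton_eq_iff)
    fix c d assume "(c, d) \<in> f ` Sigma M W" and ne: "(a, b) \<noteq> (c, d)"
    then obtain u' v' w' where uv': "(u', v') \<in> M" "w' \<in> W (u', v')" "c = {u', w'}" "d = {w', v'}"
      unfolding f_def by auto
    show "{a, b} \<inter> {c, d} = {}"
      using same[OF uv(1,2) uv'(1,2)] ne unfolding uv(3,4) uv'(3,4) by blast
  qed
qed

text \<open>The union bound over all rankings and all sets \<open>M\<close> of \<open>m\<close> pairs of vertices, of which there are
  at most \<open>(n\<^sup>2)\<^sup>n\<close> and \<open>(n\<^sup>2)\<^sup>m\<close>. Discarding the at most \<open>2 * m\<close> middle vertices that lie on the matching itself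
  leaves \<open>N\<close> paths for each of its arcs, hence \<open>m * N\<close> disjoint paths in total.\<close>

lemma exists_sparse_probe_set:
  fixes V :: "'a set" and k m N :: nat
  assumes VE: "simple_graph V E" and k: "k > 0"
    and small: "real k * (real (card V) ^ 2) ^ card V * (real (card V) ^ 2) ^ m
                  * (1 - 1 / real k ^ 2) ^ (m * N) < 1"
  shows "\<exists>Q\<subseteq>E. k * card Q \<le> card E \<and>
    (\<forall>r M. (\<forall>v\<in>V. r v < card V ^ 2) \<longrightarrow> M \<subseteq> V \<times> V \<longrightarrow> matching M \<longrightarrow> card M = m \<longrightarrow>
       (\<forall>(u, v)\<in>M. N + 2 * m \<le> card {w. (u, w) \<in> ranked_arcs E r \<and> (w, v) \<in> ranked_arcs E r}) \<longrightarrow>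
       (\<exists>p\<in>M. p \<in> ranked_arcs Q r O ranked_arcs Q r))"
proof -
  define n where "n = card V"
  have V: "finite V" using VE by (simp add: simple_graph_def)
  have "E \<subseteq> Pow V" using VE by (auto simp: simple_graph_def)
  then have E: "finite E" using V by (meson finite_Pow_iff finite_subset)
  define mids where "mids r p = {w. (fst p, w) \<in> ranked_arcs E r \<and> (w, snd p) \<in> ranked_arcs E r}"
    for r :: "'a \<Rightarrow> nat" and p
  have midsV: "mids r p \<subseteq> V" for r p
    using simple_graph_edgeD[OF VE] unfolding mids_def ranked_arcs_def by blast
  define f :: "('a \<times> 'a) \<times> 'a \<Rightarrow> 'a set \<times> 'a set" where "f = (\<lambda>((u, v), w). ({u, w}, {w, v}))"
  define paths where "paths r M = f ` Sigma M (\<lambda>p. mids r p - Field M)" for r M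
  define Rk where "Rk = (V \<rightarrow>\<^sub>E {..<n ^ 2})"
  define Ms where "Ms = {M. M \<subseteq> V \<times> V \<and> card M = m}"
  define C where "C = {(r, M) \<in> Rk \<times> Ms. matching M \<and> (\<forall>p\<in>M. N + 2 * m \<le> card (mids r p))}"
  define \<B> where "\<B> = (\<lambda>(r, M). paths r M) ` C"
  have finRk: "finite Rk" and cRk: "card Rk = (n ^ 2) ^ n"
    using V by (simp_all add: Rk_def finite_PiE card_PiE n_def)
  have finMs: "finite Ms" using V by (simp add: Ms_def)
  have cMs: "card Ms \<le> (n ^ 2) ^ m"
  proof -
    have "card Ms = (n ^ 2) choose m"
      using n_subsets[of "V \<times> V" m] V by (simp add: Ms_def n_def card_cartesian_product power2_eq_square)
    also have "\<dots> \<le> (n ^ 2) ^ m"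
      by (cases "m \<le> n ^ 2") (simp_all add: binomial_le_pow binomial_eq_0)
    finally show ?thesis .
  qed
  have C_sub: "C \<subseteq> Rk \<times> Ms" unfolding C_def by blast
  have finC: "finite C" using C_sub finRk finMs by (meson finite_SigmaI finite_subset)
  have "card \<B> \<le> card C" unfolding \<B>_def using finC by (rule card_image_le)
  also have "\<dots> \<le> card (Rk \<times> Ms)" using C_sub finRk finMs by (intro card_mono) auto
  also have "\<dots> \<le> (n ^ 2) ^ n * (n ^ 2) ^ m"
    unfolding card_cartesian_product cRk using cMs by (rule mult_le_mono2)
  finally have "real (card \<B>) \<le> real ((n ^ 2) ^ n * (n ^ 2) ^ m)" by (rule of_nat_mono)
  then have cB: "real (card \<B>) \<le> (real n ^ 2) ^ n * (real n ^ 2) ^ m" by simp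
  have q: "0 \<le> 1 - 1 / real k ^ 2" using k by (auto simp: field_simps)
  have "real k * real (card \<B>) * (1 - 1 / real k ^ 2) ^ (m * N)
      \<le> real k * ((real n ^ 2) ^ n * (real n ^ 2) ^ m) * (1 - 1 / real k ^ 2) ^ (m * N)"
    using cB q by (intro mult_right_mono mult_left_mono) auto
  also have "\<dots> < 1" using small unfolding n_def by (simp only: mult.assoc)
  finally have small': "real k * real (card \<B>) * (1 - 1 / real k ^ 2) ^ (m * N) < 1" .
  have good: "matching P \<and> P \<subseteq> E \<times> E \<and> m * N \<le> card P" if P: "P \<in> \<B>" for P
  proof -
    obtain r M where rM: "(r, M) \<in> C" "P = paths r M" using P unfolding \<B>_def by auto
    have M: "matching M" "M \<subseteq> V \<times> V" "card M = m" and big: "\<And>p. p \<in> M \<Longrightarrow> N + 2 * m \<le> card (mids r p)"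
      using rM(1) unfolding C_def Ms_def by auto
    have finM: "finite M" using M(2) V by (meson finite_SigmaI finite_subset)
    have "card (Domain M) \<le> m" "card (Range M) \<le> m"
      unfolding fst_eq_Domain[symmetric] snd_eq_Range[symmetric] M(3)[symmetric]
      by (rule card_image_le[OF finM])+
    then have "card (Field M) \<le> 2 * m"
      using card_Un_le[of "Domain M" "Range M"] unfolding Field_def by linarith
    then have "N \<le> card (mids r p - Field M)" if "p \<in> M" for p
      using big[OF that] diff_card_le_card_Diff[of "Field M" "mids r p"] finM
      by (simp add: finite_Field)
    then have "(\<Sum>p\<in>M. N) \<le> (\<Sum>p\<in>M. card (mids r p - Field M))" by (rule sum_mono)
    also have "\<dots> = card (Sigma M (\<lambda>p. mids r p - Field M))"
      using finM finite_subset[OF midsV V] by (subst card_SigmaI) auto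
    also have "\<dots> = card P"
      unfolding rM(2) paths_def f_def by (rule card_image[symmetric], rule matching_two_paths(2)[OF M(1)]) simp
    finally have "m * N \<le> card P" using M(3) by simp
    moreover have "matching P"
      unfolding rM(2) paths_def f_def by (rule matching_two_paths(1)[OF M(1)]) simp
    moreover have "P \<subseteq> E \<times> E"
      unfolding rM(2) paths_def f_def mids_def ranked_arcs_def by auto
    ultimately show ?thesis by blast
  qed
  have "finite \<B>" using finC unfolding \<B>_def by simp
  from exists_sparse_set_hitting_matchings[OF E this k good small']
  obtain Q where Q: "Q \<subseteq> E" "k * card Q \<le> card E" "\<And>P. P \<in> \<B> \<Longrightarrow> \<exists>(a, b)\<in>P. a \<in> Q \<and> b \<in> Q" by blast
  have "\<exists>p\<in>M. p \<in> ranked_arcs Q r O ranked_arcs Q r"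
    if r: "\<forall>v\<in>V. r v < card V ^ 2" and M: "M \<subseteq> V \<times> V" "matching M" "card M = m"
      and big: "\<forall>(u, v)\<in>M. N + 2 * m \<le> card {w. (u, w) \<in> ranked_arcs E r \<and> (w, v) \<in> ranked_arcs E r}"
    for r M
  proof -
    \<comment> \<open>Only rankings that are \<open>undefined\<close> outside \<open>V\<close> were counted, but the arcs depend on \<open>V\<close> alone.\<close>
    have arcs: "ranked_arcs E (restrict r V) = ranked_arcs E r"
      unfolding ranked_arcs_def using simple_graph_edgeD[OF VE] by auto
    then have mids_restrict: "mids (restrict r V) = mids r" unfolding mids_def by presburger
    have "restrict r V \<in> Rk" using r unfolding Rk_def n_def by auto
    moreover have "\<forall>p\<in>M. N + 2 * m \<le> card (mids (restrict r V) p)"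
      unfolding mids_restrict using big by (auto simp: mids_def)
    ultimately have "(restrict r V, M) \<in> C" using M unfolding C_def Ms_def by simp
    then have "paths (restrict r V) M \<in> \<B>" unfolding \<B>_def by auto
    from Q(3)[OF this] obtain u v w where uvw: "(u, v) \<in> M" "w \<in> mids (restrict r V) (u, v)"
      "{u, w} \<in> Q" "{w, v} \<in> Q" unfolding paths_def f_def by auto
    then have "r u < r w" "r w < r v"
      unfolding mids_restrict by (auto simp: mids_def ranked_arcs_def)
    then have "(u, v) \<in> ranked_arcs Q r O ranked_arcs Q r"
      using uvw(3,4) unfolding ranked_arcs_def by auto
    then show ?thesis using uvw(1) by blast
  qed
  with Q(1,2) show ?thesis by (intro exI[of _ Q] conjI allI impI) assumption+
qed

section \<open>The number of questions\<close>

text \<open>Edges that \<open>D\<close> already orients are included unless a path bridges them. Asking them again is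
  harmless, because the estimate below is for all unbridged arcs of an extension of \<open>D\<close>.\<close>

definition undecided :: "'a set set \<Rightarrow> ('a \<times> 'a) set \<Rightarrow> 'a set set" where
  "undecided E D = {e \<in> E. \<forall>u v. e = {u, v} \<longrightarrow> (u, v) \<notin> D O D}"

text \<open>The unbridged arcs of an extension of \<open>D\<close> split into those with few paths of length two (\<open>A\<close>) and
  those with many (\<open>B\<close>). A matching of size \<open>m\<close> in \<open>B\<close> would contain an arc bridged by answers to \<open>Q\<close>.\<close>

lemma card_undecided_le:
  fixes m N :: nat
  assumes VE: "simple_graph V E" and ne: "V \<noteq> {}"
    and D: "\<forall>(u, v)\<in>D. {u, v} \<in> E" "acyclic D"
    and Q: "\<forall>u v. {u, v} \<in> Q \<longrightarrow> (u, v) \<in> D \<or> (v, u) \<in> D"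
    and hit: "\<And>r M. \<forall>v\<in>V. r v < card V ^ 2 \<Longrightarrow> M \<subseteq> V \<times> V \<Longrightarrow> matching M \<Longrightarrow> card M = m \<Longrightarrow>
       \<forall>(u, v)\<in>M. N + 2 * m \<le> card {w. (u, w) \<in> ranked_arcs E r \<and> (w, v) \<in> ranked_arcs E r} \<Longrightarrow>
       \<exists>p\<in>M. p \<in> ranked_arcs Q r O ranked_arcs Q r"
  shows "real (card (undecided E D)) \<le> (real (card V) ^ 2 + 3 * (real N + 2 * real m) * real (card V)) / 4
           + 4 * real m * real (card V)"
proof -
  have V: "finite V" using VE by (simp add: simple_graph_def)
  obtain r where r: "inj_on r V" "\<forall>v\<in>V. r v < card V ^ 2" "D \<subseteq> ranked_arcs E r"
    using exists_ranking[OF VE D] by blast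
  define F where "F = ranked_arcs E r"
  have FV: "F \<subseteq> V \<times> V" using simple_graph_edgeD[OF VE] unfolding F_def ranked_arcs_def by auto
  have Fr: "r u < r v" if "(u, v) \<in> F" for u v using that unfolding F_def ranked_arcs_def by simp
  define mids where "mids p = {w. (fst p, w) \<in> F \<and> (w, snd p) \<in> F}" for p
  define A where "A = {p \<in> F - D O D. card (mids p) < N + 2 * m}"
  define B where "B = {p \<in> F - D O D. N + 2 * m \<le> card (mids p)}"
  have AV: "A \<subseteq> V \<times> V" and BV: "B \<subseteq> V \<times> V" using FV unfolding A_def B_def by auto
  have fin: "finite A" "finite B" using AV BV V by (meson finite_SigmaI finite_subset)+
  have "undecided E D \<subseteq> (\<lambda>(u, v). {u, v}) ` (A \<union> B)"
  proof
    fix e assume e: "e \<in> undecided E D"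
    then have "e \<in> E" by (simp add: undecided_def)
    then have "card e = 2" using VE by (simp add: simple_graph_def)
    then obtain u v where uv: "e = {u, v}" "u \<noteq> v" by (meson card_2_iff)
    have "(u, v) \<in> F \<or> (v, u) \<in> F"
      using ranked_arcs_acyclic_orientation[OF VE r(1)] \<open>e \<in> E\<close> uv
      unfolding F_def acyclic_orientation_def by blast
    moreover have "(u, v) \<notin> D O D" "(v, u) \<notin> D O D"
      using e uv(1) unfolding undecided_def by (auto simp: insert_commute)
    ultimately have "(u, v) \<in> A \<union> B \<or> (v, u) \<in> A \<union> B" unfolding A_def B_def by auto
    then show "e \<in> (\<lambda>(u, v). {u, v}) ` (A \<union> B)"
      using uv(1) by (auto simp: insert_commute intro: rev_image_eqI)
  qed
  then have "card (undecided E D) \<le> card (A \<union> B)"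
    using fin by (intro surj_card_le) auto
  also have "\<dots> \<le> card A + card B" by (rule card_Un_le)
  finally have split: "real (card (undecided E D)) \<le> real (card A) + real (card B)" by linarith
  have A_le: "4 * real (card A) \<le> real (card V) ^ 2 + 3 * real (N + 2 * m) * real (card V)"
  proof (rule card_arcs_few_transitive_triangles[OF V AV])
    show "r u < r v" if "(u, v) \<in> A" for u v using that Fr unfolding A_def by blast
    fix u v assume uv: "(u, v) \<in> A"
    have "{w. (u, w) \<in> A \<and> (w, v) \<in> A} \<subseteq> mids (u, v)" unfolding A_def mids_def by auto
    moreover have "finite (mids (u, v))" by (rule finite_subset[OF _ V]) (use FV in \<open>auto simp: mids_def\<close>)
    ultimately have "card {w. (u, w) \<in> A \<and> (w, v) \<in> A} \<le> card (mids (u, v))" by (intro card_mono)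
    also have "\<dots> \<le> N + 2 * m" using uv unfolding A_def by simp
    finally show "real (card {w. (u, w) \<in> A \<and> (w, v) \<in> A}) \<le> real (N + 2 * m)" by linarith
  qed simp
  have "\<not> 4 * m * card V \<le> card B"
  proof
    assume "4 * m * card V \<le> card B"
    moreover have "irrefl B" using Fr unfolding B_def irrefl_def by blast
    ultimately obtain M where M: "M \<subseteq> B" "matching M" "card M = m"
      using exists_matching[OF V ne BV] by blast
    have "\<exists>p\<in>M. p \<in> ranked_arcs Q r O ranked_arcs Q r"
    proof (rule hit[OF r(2) _ M(2,3)])
      show "M \<subseteq> V \<times> V" using M(1) BV by blast
      show "\<forall>(u, v)\<in>M. N + 2 * m \<le> card {w. (u, w) \<in> ranked_arcs E r \<and> (w, v) \<in> ranked_arcs E r}"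
        using M(1) unfolding B_def mids_def F_def by fastforce
    qed
    moreover have "ranked_arcs Q r \<subseteq> D"
    proof
      fix p assume "p \<in> ranked_arcs Q r"
      then obtain u v where p: "p = (u, v)" "{u, v} \<in> Q" "r u < r v" unfolding ranked_arcs_def by auto
      moreover have "(v, u) \<notin> D" using p(3) r(3) unfolding ranked_arcs_def by auto
      ultimately show "p \<in> D" using Q by blast
    qed
    ultimately show False using M(1) unfolding B_def by blast
  qed
  then have "real (card B) \<le> real (4 * m * card V)" by linarith
  then have B_le: "real (card B) \<le> 4 * real m * real (card V)" by simp
  have "real (card A) \<le> (real (card V) ^ 2 + 3 * (real N + 2 * real m) * real (card V)) / 4"
    using A_le by simp
  from order_trans[OF split add_mono[OF this B_le]] show ?thesis .
qed

lemma game_length_le: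
  fixes V :: "'a set" and k m N :: nat
  assumes VE: "simple_graph V E" and ne: "V \<noteq> {}" and k: "k > 0"
    and small: "real k * (real (card V) ^ 2) ^ card V * (real (card V) ^ 2) ^ m
                  * (1 - 1 / real k ^ 2) ^ (m * N) < 1"
  shows "real (game_length E) \<le> real (card V) ^ 2 / real k
           + (real (card V) ^ 2 + 3 * (real N + 2 * real m) * real (card V)) / 4
           + 4 * real m * real (card V)" (is "_ \<le> _ + ?b1 + ?b2")
proof -
  define b where "b = ?b1 + ?b2"
  have V: "finite V" and card2: "\<forall>e\<in>E. card e = 2" using VE by (auto simp: simple_graph_def)
  have "E \<subseteq> Pow V" using VE by (auto simp: simple_graph_def)
  then have E: "finite E" using V by (meson finite_Pow_iff finite_subset)
  obtain Q where Q: "Q \<subseteq> E" "k * card Q \<le> card E"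
    and hit: "\<And>r M. \<forall>v\<in>V. r v < card V ^ 2 \<Longrightarrow> M \<subseteq> V \<times> V \<Longrightarrow> matching M \<Longrightarrow> card M = m \<Longrightarrow>
       \<forall>(u, v)\<in>M. N + 2 * m \<le> card {w. (u, w) \<in> ranked_arcs E r \<and> (w, v) \<in> ranked_arcs E r} \<Longrightarrow>
       \<exists>p\<in>M. p \<in> ranked_arcs Q r O ranked_arcs Q r"
    using exists_sparse_probe_set[OF VE k small] by blast
  have "algy_wins E (card Q + nat \<lfloor>b\<rfloor>) {}"
  proof (rule algy_wins_after_queries[OF finite_subset[OF Q(1) E] Q(1) card2])
    fix D assume D: "\<forall>(u, v)\<in>D. {u, v} \<in> E" "acyclic D"
      "\<forall>u v. {u, v} \<in> Q \<longrightarrow> (u, v) \<in> D \<or> (v, u) \<in> D"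
    have U: "undecided E D \<subseteq> E" unfolding undecided_def by blast
    have "algy_wins E (card (undecided E D) + 0) D"
    proof (rule algy_wins_after_queries[OF finite_subset[OF U E] U card2 D(1,2)])
      fix D' assume D': "D \<subseteq> D'" "\<forall>(u, v)\<in>D'. {u, v} \<in> E" "acyclic D'"
        "\<forall>u v. {u, v} \<in> undecided E D \<longrightarrow> (u, v) \<in> D' \<or> (v, u) \<in> D'"
      have "(u, v) \<in> D' \<or> (v, u) \<in> D' \<or> (u, v) \<in> D' O D' \<or> (v, u) \<in> D' O D'"
        if e: "{u, v} \<in> E" for u v
      proof (cases "{u, v} \<in> undecided E D")
        case False
        then have "(u, v) \<in> D O D \<or> (v, u) \<in> D O D"
          using e unfolding undecided_def by (auto simp: doubleton_eq_iff)
        then show ?thesis using D'(1) by blast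
      qed (use D'(4) in blast)
      then show "algy_wins E 0 D'" using game_over_if_two_paths[OF VE D'(2,3)] by simp
    qed
    moreover have "card (undecided E D) \<le> nat \<lfloor>b\<rfloor>"
      using card_undecided_le[OF VE ne D hit] unfolding b_def by (intro le_nat_floor)
    ultimately show "algy_wins E (nat \<lfloor>b\<rfloor>) D" by (metis add.right_neutral algy_wins_mono)
  qed (auto simp: acyclic_def)
  then have "game_length E \<le> card Q + nat \<lfloor>b\<rfloor>" unfolding game_length_def by (rule Least_le)
  moreover have "real (nat \<lfloor>b\<rfloor>) \<le> b" by (rule of_nat_floor) (simp add: b_def)
  moreover have "real (card Q) \<le> real (card V) ^ 2 / real k"
  proof -
    have "E \<subseteq> (\<lambda>(u, v). {u, v}) ` (V \<times> V)"
    proof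
      fix e assume e: "e \<in> E"
      then obtain u v where "e = {u, v}" using card2 by (meson card_2_iff)
      then show "e \<in> (\<lambda>(u, v). {u, v}) ` (V \<times> V)" using e simple_graph_edgeD[OF VE] by auto
    qed
    then have "card E \<le> card (V \<times> V)" using V by (intro surj_card_le) auto
    then have "card Q * k \<le> card V ^ 2"
      using Q(2) by (simp add: card_cartesian_product power2_eq_square mult.commute)
    then have "real (card Q) * real k \<le> real (card V) ^ 2"
      by (metis of_nat_le_iff of_nat_mult of_nat_power)
    then show ?thesis using k by (simp add: field_simps)
  qed
  ultimately show ?thesis unfolding b_def by linarith
qed

text \<open>With \<open>m = N = \<mu> n\<close>, the number \<open>n\<^sup>2\<^sup>n\<^sup>+\<^sup>2\<^sup>m = exp (O (n ln n))\<close> of configurations loses against the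
  failure probability \<open>exp (- c \<mu>\<^sup>2 n\<^sup>2)\<close>.\<close>

lemma eventually_union_bound_lt_1:
  fixes \<mu> :: real and k :: nat
  assumes \<mu>: "0 < \<mu>" "\<mu> \<le> 1" and k: "k \<ge> 2"
  shows "eventually (\<lambda>n. real k * (real n ^ 2) ^ n * (real n ^ 2) ^ (nat \<lfloor>\<mu> * real n\<rfloor>)
           * (1 - 1 / real k ^ 2) ^ (nat \<lfloor>\<mu> * real n\<rfloor> * nat \<lfloor>\<mu> * real n\<rfloor>) < 1) sequentially"
proof -
  define q where "q = 1 - 1 / real k ^ 2"
  have "1 < real k ^ 2" using k by (intro one_less_power) auto
  then have q: "0 < q" "q < 1" using k unfolding q_def by (auto simp: divide_less_eq)
  define c where "c = - ln q"
  have c: "c > 0" using q by (simp add: c_def ln_less_zero)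
  have ev: "eventually (\<lambda>n::nat. ln (real k) + 4 * real n * ln (real n) - c * (\<mu> * real n / 2) ^ 2 < 0) sequentially"
    using c \<mu>(1) by real_asymp
  have "eventually (\<lambda>n::nat. 2 \<le> \<mu> * real n) sequentially" using \<mu>(1) by real_asymp
  with ev show ?thesis
  proof eventually_elim
    case (elim n)
    define m where "m = nat \<lfloor>\<mu> * real n\<rfloor>"
    have n: "n > 0" using elim(2) by (cases n) auto
    have m_ge: "\<mu> * real n / 2 \<le> real m" using elim(2) unfolding m_def by linarith
    have "\<mu> * real n \<le> 1 * real n" using \<mu> by (intro mult_right_mono) auto
    then have m_le: "m \<le> n" unfolding m_def by linarith
    have "(real n ^ 2) ^ n * (real n ^ 2) ^ m = real n ^ (2 * n + 2 * m)"
      by (simp only: power_mult power_add)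
    also have "\<dots> \<le> real n ^ (4 * n)" using n m_le by (intro power_increasing) auto
    also have "\<dots> = exp (4 * real n * ln (real n))"
      using n exp_of_nat_mult[of "4 * n" "ln (real n)"] by simp
    finally have 1: "(real n ^ 2) ^ n * (real n ^ 2) ^ m \<le> exp (4 * real n * ln (real n))" .
    have "q ^ (m * m) = exp (- c * real m ^ 2)"
      using q exp_of_nat_mult[of "m * m" "ln q"] by (simp add: c_def power2_eq_square mult.commute)
    also have "\<dots> \<le> exp (- c * (\<mu> * real n / 2) ^ 2)"
      using c m_ge \<mu>(1) by (simp add: power_mono)
    finally have 2: "q ^ (m * m) \<le> exp (- c * (\<mu> * real n / 2) ^ 2)" .
    have "real k * ((real n ^ 2) ^ n * (real n ^ 2) ^ m) * q ^ (m * m)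
        \<le> exp (ln (real k)) * exp (4 * real n * ln (real n)) * exp (- c * (\<mu> * real n / 2) ^ 2)"
      using k q by (intro mult_mono 1 2) auto
    also have "\<dots> = exp (ln (real k) + 4 * real n * ln (real n) - c * (\<mu> * real n / 2) ^ 2)"
      by (simp only: exp_add[symmetric] diff_conv_add_uminus mult_minus_left)
    also have "\<dots> < 1" using elim(1) by simp
    finally show ?case unfolding m_def q_def by (simp only: mult.assoc)
  qed
qed

theorem theorem1p1:
  fixes \<epsilon> :: real
  assumes "\<epsilon> > 0"
  shows "\<exists>n\<^sub>0::nat. \<forall>(V :: 'a set) E. simple_graph V E \<and> card V \<ge> n\<^sub>0 \<longrightarrow>
           real (game_length E) \<le> (1/4 + \<epsilon>) * (real (card V))\<^sup>2"
proof -
  \<comment> \<open>The error terms add up to \<open>1 / k + 25 / 4 * \<mu>\<close>.\<close>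
  define \<mu> where "\<mu> = min \<epsilon> 1 / 16"
  have \<mu>: "0 < \<mu>" "\<mu> \<le> 1" "16 * \<mu> \<le> \<epsilon>" using assms by (auto simp: \<mu>_def)
  define k where "k = nat \<lceil>2 / \<epsilon>\<rceil> + 2"
  have k: "k \<ge> 2" "2 / \<epsilon> \<le> real k" unfolding k_def by (simp, linarith)
  then have k': "1 / real k \<le> \<epsilon> / 2" using assms by (simp add: field_simps)
  obtain n\<^sub>0 where n\<^sub>0: "\<And>n. n \<ge> n\<^sub>0 \<Longrightarrow> real k * (real n ^ 2) ^ n * (real n ^ 2) ^ (nat \<lfloor>\<mu> * real n\<rfloor>)
      * (1 - 1 / real k ^ 2) ^ (nat \<lfloor>\<mu> * real n\<rfloor> * nat \<lfloor>\<mu> * real n\<rfloor>) < 1"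
    using eventually_union_bound_lt_1[OF \<mu>(1,2) k(1)] unfolding eventually_sequentially by blast
  have "real (game_length E) \<le> (1/4 + \<epsilon>) * (real (card V))\<^sup>2"
    if VE: "simple_graph V E" and n: "card V \<ge> max n\<^sub>0 1" for V :: "'a set" and E
  proof -
    define n where "n = real (card V)"
    define m where "m = nat \<lfloor>\<mu> * n\<rfloor>"
    have "V \<noteq> {}" using n by auto
    moreover have "k > 0" using k by simp
    ultimately have "real (game_length E) \<le> n ^ 2 / real k + (n ^ 2 + 3 * (real m + 2 * real m) * n) / 4
        + 4 * real m * n"
      using game_length_le[OF VE, of k m m] n\<^sub>0[of "card V"] n unfolding m_def n_def by simp
    also have "\<dots> = n ^ 2 * (1 / real k) + n ^ 2 / 4 + 25 / 4 * (real m * n)" by (simp add: field_simps)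
    also have "\<dots> \<le> n ^ 2 * (\<epsilon> / 2) + n ^ 2 / 4 + 25 / 4 * ((\<mu> * n) * n)"
    proof -
      have "real m \<le> \<mu> * n" unfolding m_def using \<mu>(1) by (intro of_nat_floor) (simp add: n_def)
      then have "real m * n \<le> (\<mu> * n) * n" by (intro mult_right_mono) (auto simp: n_def)
      moreover have "n ^ 2 * (1 / real k) \<le> n ^ 2 * (\<epsilon> / 2)" using k' by (intro mult_left_mono) auto
      ultimately show ?thesis by linarith
    qed
    also have "\<dots> = (\<epsilon> / 2 + 1 / 4 + 25 / 4 * \<mu>) * n ^ 2" by (simp add: power2_eq_square algebra_simps)
    also have "\<dots> \<le> (1 / 4 + \<epsilon>) * n ^ 2" using \<mu> by (intro mult_right_mono) auto
    finally show ?thesis unfolding n_def .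
  qed
  then show ?thesis by (intro exI[of _ "max n\<^sub>0 1"]) auto
qed

end
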